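(* For all nonnegative integers $a \leq n$, \[ F(G(n,a)) = \begin{cases} 1 & n < 3, \\ \binom{n}{a} & n \geq 3. \end{cases} \]
   Context: For nonnegative integers $a \le n$, $G(n,a)$ denotes the graph obtained from the complete bipartite graph $K_{a,n-a}$ (parts of sizes $a$ and $n-a$) by removing the edges of a maximal matching. For a finite graph $G$, a permutation of the vertices of $G$ is a sequence listing every vertex of $G$ exactly once; two such permutations $\pi,\sigma$ are $G$-different if there is an index $i$ such that $\{\pi(i),\sigma(i)\}$ is an edge of $G$; $F(G)$ denotes the maximum size of a family of pairwise $G$-different permutations of the vertices of $G$. *)

theory Defs
  imports Main "HOL-Combinatorics.Multiset_Permutations"
begin

record 'a ugraph =
  verts :: "'a set"
  edges :: "'a set set"

definition complete_bipartite :: "'a set \<Rightarrow> 'a set \<Rightarrow> 'a ugraph" where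
  "complete_bipartite A B = \<lparr>verts = A \<union> B, edges = {{x, y} | x y. x \<in> A \<and> y \<in> B}\<rparr>"

definition matching :: "'a ugraph \<Rightarrow> 'a set set \<Rightarrow> bool" where
  "matching G M \<longleftrightarrow> M \<subseteq> edges G \<and> pairwise disjnt M"

definition maximal_matching :: "'a ugraph \<Rightarrow> 'a set set \<Rightarrow> bool" where
  "maximal_matching G M \<longleftrightarrow>
    matching G M \<and> (\<forall>M'. matching G M' \<and> M \<subseteq> M' \<longrightarrow> M' = M)"

definition remove_edges :: "'a ugraph \<Rightarrow> 'a set set \<Rightarrow> 'a ugraph" where
  "remove_edges G M = G\<lparr>edges := edges G - M\<rparr>"

text \<open>
  The graph \<open>G(n,a)\<close> is determined only up to isomorphism: its vertices and the removed
  matching are not specified. It is therefore given as a predicate satisfied by every graph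
  that arises from the construction.
\<close>

definition is_G :: "nat \<Rightarrow> nat \<Rightarrow> 'a ugraph \<Rightarrow> bool" where
  "is_G n a G \<longleftrightarrow> (\<exists>A B M.
     finite A \<and> finite B \<and> A \<inter> B = {} \<and> card A = a \<and> card B = n - a \<and>
     maximal_matching (complete_bipartite A B) M \<and>
     G = remove_edges (complete_bipartite A B) M)"

lemma ex_is_G: "\<exists>G :: nat ugraph. is_G n a G"
proof -
  define A where "A = {..<a}"
  define B where "B = {a..<a + (n - a)}"
  define K where "K = complete_bipartite A B"
  have "edges K \<subseteq> Pow (A \<union> B)"
    by (auto simp: K_def complete_bipartite_def)
  then have "finite (edges K)"
    by (rule finite_subset) (simp add: A_def B_def)
  moreover have "Collect (matching K) \<subseteq> Pow (edges K)"
    by (auto simp: matching_def)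
  ultimately have "finite (Collect (matching K))"
    by (meson finite_Pow_iff finite_subset)
  moreover have "{} \<in> Collect (matching K)"
    by (simp add: matching_def)
  ultimately obtain M where "M \<in> Collect (matching K)"
      "\<forall>M' \<in> Collect (matching K). M \<subseteq> M' \<longrightarrow> M = M'"
    using finite_has_maximal[of "Collect (matching K)"] by blast
  then have "maximal_matching K M"
    by (auto simp: maximal_matching_def)
  moreover have "A \<inter> B = {}" "finite A" "finite B" "card A = a" "card B = n - a"
    by (auto simp: A_def B_def)
  ultimately show ?thesis
    unfolding is_G_def K_def by blast
qed

definition G_different :: "'a ugraph \<Rightarrow> 'a list \<Rightarrow> 'a list \<Rightarrow> bool" where
  "G_different G \<pi> \<sigma> \<longleftrightarrow> (\<exists>i < card (verts G). {\<pi> ! i, \<sigma> ! i} \<in> edges G)"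

definition F :: "'a ugraph \<Rightarrow> nat" where
  "F G = Max {card S | S. S \<subseteq> permutations_of_set (verts G) \<and> pairwise (G_different G) S}"

end

(*
  Two permutations of the vertices of a bipartite graph whose A-vertices occupy the same positions
  are never G-different, so a family has at most as many members as there are a-subsets of the
  positions.  Conversely Pascal's rule builds a family of that size: if x in A and y in B are
  adjacent, prefix x to a family for G - x and y to a family for G - y; two members with different
  heads differ in the first position.  Such an edge exists as soon as both parts are nonempty and
  there are at least 3 vertices.  The recursion must stop at 3 vertices, because K_{1,1} minus its
  edge has only the trivial family; there the cyclic shifts of [x, y, z] serve.
*)
theory Submission imports Defs
begin

abbreviation bipartite_minus :: "'a set \<Rightarrow> 'a set \<Rightarrow> 'a set set \<Rightarrow> 'a ugraph" where
  "bipartite_minus A B M \<equiv> remove_edges (complete_bipartite A B) M"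

lemma verts_bipartite_minus [simp]: "verts (bipartite_minus A B M) = A \<union> B"
  by (simp add: remove_edges_def complete_bipartite_def)

lemma edge_bipartite_minus_iff:
  "{u, v} \<in> edges (bipartite_minus A B M) \<longleftrightarrow>
    (u \<in> A \<and> v \<in> B \<or> v \<in> A \<and> u \<in> B) \<and> {u, v} \<notin> M"
  by (auto simp: remove_edges_def complete_bipartite_def doubleton_eq_iff)

lemma G_different_sym: "G_different G \<pi> \<sigma> \<Longrightarrow> G_different G \<sigma> \<pi>"
  unfolding G_different_def by (metis insert_commute)

text \<open>\<open>Max\<close> is informative only on a finite set. Here the cardinalities form one
  because a finite vertex set has finitely many permutations, hence finitely many families.\<close>

lemma F_eqI:
  assumes "finite (verts G)"
    and "S \<subseteq> permutations_of_set (verts G)" "pairwise (G_different G) S" "card S = k"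
    and "\<And>T. T \<subseteq> permutations_of_set (verts G) \<Longrightarrow> pairwise (G_different G) T \<Longrightarrow> card T \<le> k"
  shows "F G = k"
proof -
  let ?C = "{card S | S. S \<subseteq> permutations_of_set (verts G) \<and> pairwise (G_different G) S}"
  have "?C \<subseteq> card ` Pow (permutations_of_set (verts G))"
    by auto
  then have "finite ?C"
    by (rule finite_subset) simp
  then show ?thesis
    unfolding F_def using assms(2-5) by (intro Max_eqI) auto
qed

lemma card_positions:
  assumes "\<pi> \<in> permutations_of_set V" "A \<subseteq> V"
  shows "card {i. i < length \<pi> \<and> \<pi> ! i \<in> A} = card A"
proof -
  have "distinct \<pi>" "set \<pi> = V"
    using assms(1) by (auto simp: permutations_of_set_def)
  then have "inj_on ((!) \<pi>) {i. i < length \<pi> \<and> \<pi> ! i \<in> A}"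
    by (auto simp: inj_on_def nth_eq_iff_index_eq)
  moreover have "(!) \<pi> ` {i. i < length \<pi> \<and> \<pi> ! i \<in> A} = A"
    using assms(2) \<open>set \<pi> = V\<close> by (force simp: in_set_conv_nth)
  ultimately show ?thesis
    using card_image by fastforce
qed

lemma card_family_le:
  assumes "finite A" "finite B" "A \<inter> B = {}"
    and S: "S \<subseteq> permutations_of_set (A \<union> B)" "pairwise (G_different (bipartite_minus A B M)) S"
  shows "card S \<le> (card A + card B) choose card A"
proof -
  define N where "N = card (A \<union> B)"
  define P where "P \<pi> = {i. i < N \<and> \<pi> ! i \<in> A}" for \<pi> :: "'a list"
  have N: "N = card A + card B"
    unfolding N_def using assms(1-3) by (rule card_Un_disjoint)
  have len: "length \<pi> = N" "set \<pi> = A \<union> B" if "\<pi> \<in> S" for \<pi>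
    using S(1) that by (auto simp: N_def length_finite_permutations_of_set permutations_of_set_def)
  have "inj_on P S"
  proof (rule inj_onI, rule ccontr)
    fix \<pi> \<sigma> assume *: "\<pi> \<in> S" "\<sigma> \<in> S" "P \<pi> = P \<sigma>" "\<pi> \<noteq> \<sigma>"
    then have "G_different (bipartite_minus A B M) \<pi> \<sigma>"
      using S(2) by (auto simp: pairwise_def)
    then obtain i where i: "i < N" "{\<pi> ! i, \<sigma> ! i} \<in> edges (bipartite_minus A B M)"
      by (auto simp: G_different_def N_def)
    \<comment> \<open>Equal position sets put both entries at \<open>i\<close> on the same side,
      whereas every edge joins the two sides.\<close>
    moreover have "\<pi> ! i \<in> A \<longleftrightarrow> \<sigma> ! i \<in> A"
      using *(3) i(1) by (auto simp: P_def)
    ultimately show False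
      using assms(3) by (auto simp: edge_bipartite_minus_iff)
  qed
  moreover have "P ` S \<subseteq> {X. X \<subseteq> {..<N} \<and> card X = card A}"
  proof clarify
    fix \<pi> assume "\<pi> \<in> S"
    then have "card (P \<pi>) = card A"
      using card_positions[of \<pi> "A \<union> B" A] S(1) len[of \<pi>] by (auto simp: P_def)
    then show "P \<pi> \<subseteq> {..<N} \<and> card (P \<pi>) = card A"
      by (auto simp: P_def)
  qed
  ultimately have "card S \<le> card {X. X \<subseteq> {..<N} \<and> card X = card A}"
    by (intro card_inj_on_le) auto
  then show ?thesis
    by (simp add: n_subsets N)
qed

text \<open>With at least 3 vertices, one part has two elements, so a vertex of the other part has
  two candidate edges. These share an endpoint, hence \<open>M\<close> contains at most one of
  them.\<close>

lemma ex_edge_bipartite_minus: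
  assumes "pairwise disjnt M" "finite A" "finite B" "A \<noteq> {}" "B \<noteq> {}" "3 \<le> card A + card B"
  obtains x y where "x \<in> A" "y \<in> B" "{x, y} \<notin> M"
proof -
  have *: "{u, v} \<notin> M \<or> {u, w} \<notin> M" if "v \<noteq> w" for u v w
    using assms(1) that by (force simp: pairwise_def disjnt_def doubleton_eq_iff)
  obtain x y where xy: "x \<in> A" "y \<in> B"
    using assms by blast
  have "A \<noteq> {x} \<or> B \<noteq> {y}"
    using assms(6) by auto
  then consider x' where "x' \<in> A" "x' \<noteq> x" | y' where "y' \<in> B" "y' \<noteq> y"
    using xy by blast
  then show ?thesis
  proof cases
    case 1
    then show ?thesis
      using *[of x' x y] xy that by (metis insert_commute)
  next
    case 2
    then show ?thesis
      using *[of y' y x] xy that by metis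
  qed
qed

text \<open>A common head shifts the witnessing index by one; the strict inequality of cardinalities
  keeps it in range. The edge survives because both graphs remove the same \<open>M\<close>.\<close>

lemma G_different_Cons:
  assumes "G_different (bipartite_minus A' B' M) \<pi> \<sigma>"
    and "finite A" "finite B" "A' \<subseteq> A" "B' \<subseteq> B" "card (A' \<union> B') < card (A \<union> B)"
  shows "G_different (bipartite_minus A B M) (x # \<pi>) (x # \<sigma>)"
proof -
  obtain i where "i < card (A' \<union> B')" "{\<pi> ! i, \<sigma> ! i} \<in> edges (bipartite_minus A' B' M)"
    using assms(1) by (auto simp: G_different_def)
  then have "Suc i < card (A \<union> B)"
    and "{(x # \<pi>) ! Suc i, (x # \<sigma>) ! Suc i} \<in> edges (bipartite_minus A B M)"
    using assms(4-6) by (auto simp: edge_bipartite_minus_iff)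
  then show ?thesis
    unfolding G_different_def by auto
qed

text \<open>Comparing two distinct cyclic shifts position by position, each of the three pairs of
  vertices appears exactly once, so the single edge \<open>{x, y}\<close> separates them.\<close>

lemma cyclic_family:
  assumes "distinct [x, y, z]" "verts G = {x, y, z}" "{x, y} \<in> edges G"
  shows "\<exists>S \<subseteq> permutations_of_set (verts G). card S = 3 \<and> pairwise (G_different G) S"
proof (intro exI[of _ "{[x, y, z], [z, x, y], [y, z, x]}"] conjI)
  have "card (verts G) = 3" "{y, x} \<in> edges G"
    using assms by (auto simp: insert_commute)
  \<comment> \<open>The vertices \<open>x\<close> and \<open>y\<close> meet at index 1, 0 and 2
    respectively.\<close>
  then have "G_different G [x, y, z] [z, x, y]" "G_different G [x, y, z] [y, z, x]"
    "G_different G [z, x, y] [y, z, x]"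
    using assms(3) unfolding G_different_def
    by (auto intro: exI[of _ 0] exI[of _ 1] exI[of _ 2])
  then show "pairwise (G_different G) {[x, y, z], [z, x, y], [y, z, x]}"
    by (auto simp: pairwise_insert intro: G_different_sym)
qed (use assms in \<open>auto simp: permutations_of_set_def\<close>)

text \<open>The set \<open>M\<close> stays fixed while \<open>A\<close> and \<open>B\<close> shrink,
  and may contain edges at deleted vertices. Only its disjointness is assumed, since maximality need
  not survive the deletion of a vertex.\<close>

lemma ex_family:
  assumes "pairwise disjnt M" "finite A" "finite B" "A \<inter> B = {}" "3 \<le> card A + card B"
  shows "\<exists>S \<subseteq> permutations_of_set (A \<union> B). card S = (card A + card B) choose card A \<and>
    pairwise (G_different (bipartite_minus A B M)) S"
  using assms(2-5)
proof (induction "card A + card B" arbitrary: A B rule: less_induct)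
  case less
  note fin = less.prems(1,2) and disj = less.prems(3)
  let ?G = "bipartite_minus A B M"
  show ?case
  proof (cases "A = {} \<or> B = {}")
    case True
    then have "(card A + card B) choose card A = 1"
      by auto
    moreover obtain \<pi> where "\<pi> \<in> permutations_of_set (A \<union> B)"
      using fin by (metis all_not_in_conv finite_UnI permutations_of_set_empty_iff)
    ultimately show ?thesis
      by (intro exI[of _ "{\<pi>}"]) (auto simp: pairwise_def)
  next
    case False
    then obtain x y where xy: "x \<in> A" "y \<in> B" "{x, y} \<notin> M"
      using ex_edge_bipartite_minus[OF assms(1) fin] less.prems by metis
    have edge: "{x, y} \<in> edges ?G" "x \<noteq> y" "x \<notin> B" "y \<notin> A"
      using xy disj by (auto simp: edge_bipartite_minus_iff)
    have card_V: "card (A \<union> B) = card A + card B"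
      using fin disj by (rule card_Un_disjoint)
    have card_A: "card A = Suc (card (A - {x}))" and card_B: "card B = Suc (card (B - {y}))"
      using xy fin card.remove by metis+
    show ?thesis
    proof (cases "card A + card B = 3")
      case True
      then have "card (A \<union> B - {x, y}) = 1"
        using card_V xy edge(2) fin by (subst card_Diff_subset) auto
      then obtain z where z: "A \<union> B - {x, y} = {z}"
        by (auto simp: card_1_singleton_iff)
      then have "distinct [x, y, z]" "verts ?G = {x, y, z}"
        using xy edge(2) by auto
      \<comment> \<open>Both parts are nonempty, and 3 choose 1 and 3 choose 2 are both 3, the
        number of cyclic shifts.\<close>
      moreover have "card A = 1 \<or> card A = 2"
        using True card_A card_B by auto
      then have "(card A + card B) choose card A = 3"
        unfolding True by (auto simp: numeral_eq_Suc)
      ultimately show ?thesis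
        using cyclic_family[of x y z ?G] edge(1) by simp
    next
      case False
      \<comment> \<open>There are now at least 4 vertices, so deleting one stays within the range of
        the induction hypothesis.\<close>
      then have ge: "3 \<le> card (A - {x}) + card B" "3 \<le> card A + card (B - {y})"
        using less.prems(4) card_A card_B by auto
      obtain S where S: "S \<subseteq> permutations_of_set (A - {x} \<union> B)"
          "card S = (card (A - {x}) + card B) choose card (A - {x})"
          "pairwise (G_different (bipartite_minus (A - {x}) B M)) S"
        using less.hyps[of "A - {x}" B] ge fin disj card_A by auto
      obtain T where T: "T \<subseteq> permutations_of_set (A \<union> (B - {y}))"
          "card T = (card A + card (B - {y})) choose card A"
          "pairwise (G_different (bipartite_minus A (B - {y}) M)) T"
        using less.hyps[of A "B - {y}"] ge fin disj card_B by auto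
      have less_V: "card (A - {x} \<union> B) < card (A \<union> B)" "card (A \<union> (B - {y})) < card (A \<union> B)"
        using xy edge fin by (auto intro!: psubset_card_mono)
      have finST: "finite S" "finite T"
        using S(1) T(1) by (auto intro: finite_subset)
      let ?U = "(#) x ` S \<union> (#) y ` T"
      have "card ?U = card S + card T"
        using edge(2) finST by (subst card_Un_disjoint) (auto simp: card_image)
      also have "\<dots> = (card A + card B) choose card A"
        \<comment> \<open>Writing both cardinalities as successors turns the equation into Pascal's
          rule.\<close>
        unfolding S(2) T(2) unfolding card_A card_B by simp
      finally have "card ?U = (card A + card B) choose card A" .
      moreover have "?U \<subseteq> permutations_of_set (A \<union> B)"
        using S(1) T(1) xy edge by (auto simp: permutations_of_set_def)
      moreover have "pairwise (G_different ?G) ?U"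
      proof -
        have "G_different ?G (x # \<pi>) (x # \<sigma>)" if "\<pi> \<in> S" "\<sigma> \<in> S" "\<pi> \<noteq> \<sigma>" for \<pi> \<sigma>
          using G_different_Cons[OF _ fin _ _ less_V(1)] S(3) that by (auto simp: pairwise_def)
        moreover have "G_different ?G (y # \<pi>) (y # \<sigma>)" if "\<pi> \<in> T" "\<sigma> \<in> T" "\<pi> \<noteq> \<sigma>" for \<pi> \<sigma>
          using G_different_Cons[OF _ fin _ _ less_V(2)] T(3) that by (auto simp: pairwise_def)
        \<comment> \<open>The heads alone suffice: index 0 carries the edge \<open>{x, y}\<close>,
          whatever the tails are.\<close>
        moreover have "G_different ?G (x # \<pi>) (y # \<sigma>)" for \<pi> \<sigma>
          using edge(1) card_V card_A by (auto simp: G_different_def intro!: exI[of _ 0])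
        ultimately show ?thesis
          by (auto simp: pairwise_def intro: G_different_sym)
      qed
      ultimately show ?thesis
        by blast
    qed
  qed
qed

text \<open>This is where maximality of \<open>M\<close> enters: on two vertices, one in each part,
  it forces the only edge into \<open>M\<close>. If a part is empty, there is no edge to begin
  with.\<close>

lemma bipartite_minus_maximal_matching_no_edges:
  assumes "card A + card B < 3" "finite A" "finite B" "A \<inter> B = {}"
    and M: "maximal_matching (complete_bipartite A B) M"
  shows "edges (bipartite_minus A B M) = {}"
proof (cases "A = {} \<or> B = {}")
  case True
  then show ?thesis
    by (auto simp: remove_edges_def complete_bipartite_def)
next
  case False
  then have "card A > 0" "card B > 0"
    using assms by auto
  then have "card A = 1" "card B = 1"
    using assms(1) by auto
  then obtain x y where "A = {x}" "B = {y}"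
    by (auto simp: card_1_singleton_iff)
  then have E: "edges (complete_bipartite A B) = {{x, y}}"
    by (auto simp: complete_bipartite_def)
  then have "matching (complete_bipartite A B) {{x, y}}"
    by (auto simp: matching_def)
  moreover have "M \<subseteq> {{x, y}}"
    using M E by (auto simp: maximal_matching_def matching_def)
  ultimately have "M = {{x, y}}"
    using M by (auto simp: maximal_matching_def)
  then show ?thesis
    using E by (simp add: remove_edges_def)
qed

text \<open>Without edges no two permutations are \<open>G_different\<close>, so a family has at
  most one member, and a singleton attains this.\<close>

lemma F_no_edges:
  assumes "finite (verts G)" "edges G = {}"
  shows "F G = 1"
proof -
  obtain \<pi> where "\<pi> \<in> permutations_of_set (verts G)"
    using assms(1) by (metis all_not_in_conv permutations_of_set_empty_iff)
  moreover have "card T \<le> 1" if "pairwise (G_different G) T" for T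
    using that assms(2) card_le_Suc0_iff_eq[of T]
    \<comment> \<open>An infinite \<open>T\<close> has \<open>card T = 0\<close> by convention, so
      only the finite case has content.\<close>
    by (cases "finite T") (auto simp: pairwise_def G_different_def)
  ultimately show ?thesis
    using assms(1) by (intro F_eqI[of G "{\<pi>}"]) auto
qed

theorem theorem1:
  fixes n a :: nat and G :: "'a ugraph"
  assumes "a \<le> n" and "is_G n a G"
  shows "F G = (if n < 3 then 1 else n choose a)"
proof -
  obtain A B M where AB: "finite A" "finite B" "A \<inter> B = {}" "card A = a" "card B = n - a"
    and M: "maximal_matching (complete_bipartite A B) M"
    and G: "G = bipartite_minus A B M"
    using assms(2) unfolding is_G_def by blast
  \<comment> \<open>The truncated subtraction \<open>n - a\<close> is exact because
    \<open>a \<le> n\<close>.\<close>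
  have n: "card A + card B = n"
    using AB assms(1) by simp
  show ?thesis
  proof (cases "n < 3")
    case True
    then show ?thesis
      using bipartite_minus_maximal_matching_no_edges[OF _ AB(1-3) M] n AB(1,2)
      by (simp add: G F_no_edges)
  next
    case False
    have "pairwise disjnt M"
      using M by (simp add: maximal_matching_def matching_def)
    then obtain S where "S \<subseteq> permutations_of_set (verts G)" "card S = n choose a"
        "pairwise (G_different G) S"
      using ex_family[of M A B] AB(1-4) n False by (auto simp: G)
    moreover have "card T \<le> n choose a"
      if "T \<subseteq> permutations_of_set (verts G)" "pairwise (G_different G) T" for T
      using card_family_le[OF AB(1-3), of T M] that n AB(4) by (simp add: G)
    ultimately have "F G = n choose a"
      using AB(1,2) by (intro F_eqI[of G S]) (auto simp: G)
    then show ?thesis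
      using False by simp
  qed
qed

end
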